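(* Let $m\ge2$, let $C=(c_{jk})$ be an $m\times m$ cost matrix, and let $\overline C=C_M1_m^{T}-C$ with $C_M=(c_{1M},\ldots,c_{mM})^{T}$, $c_{jM}=\max_kc_{jk}$. For a scoring rule $L(j,q)$, define for each $q\in\Delta_m$ the nondecreasing function $$\psi^C_q(t)=\inf_{\eta'\in\Delta_m:\ \|\overline C^{T}(\eta'-q)\|_{\infty2}\ge t}B_L(\eta',q),\qquad t\ge0.$$ Then the regrets of the cost-weighted classification loss $L^{\mathrm{cw}}(j,\overline C^{T}q)$ and the scoring rule $L(j,q)$ satisfy, for all $\eta,q\in\Delta_m$, $$\psi^C_q\left(B^{\mathrm{cw}}(\eta,\overline C^{T}q)\right)\le B_L(\eta,q).$$
   Context: $\Delta_m=\{q\in\mathbb R^m: q_j\ge0,\ \sum_jq_j=1\}$; $1_m$ is the all-ones vector; $\|b\|_{\infty2}=\max_{j\ne k}(|b_j|+|b_k|)$. A cost matrix $C=(C_1,\ldots,C_m)$ (columns $C_k$) has $c_{jk}\ge0$, $c_{jj}=0$, and for each $j$, $c_{jk}>0$ for some $k\ne j$. A scoring rule is a loss $L(j,q)$, $j\in\{1,\dots,m\}$, with action space $\Delta_m$ and values in $(-\infty,\infty]$ (with $0\cdot\infty=0$), whose generalized entropy $H_L(\eta)=\inf_{q\in\Delta_m}\sum_j\eta_jL(j,q)$ is finite. The regret is $B_L(\eta,q)=\sum_j\eta_jL(j,q)-H_L(\eta)$. The cost-weighted classification loss is $L^{\mathrm{cw}}(j,\gamma)=c_{jk}$ if $k=\mathrm{argmax}_l\gamma_l$,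 $\gamma\in\mathbb R^m$ (ties broken by any fixed rule), with regret $B^{\mathrm{cw}}(\eta,\gamma)=\sum_j\eta_jL^{\mathrm{cw}}(j,\gamma)-\min_k\eta^{T}C_k$. The infimum over an empty set is $+\infty$. *)

theory Defs
  imports "HOL-Analysis.Analysis"
begin

text \<open>Labels \<open>{1,\<dots>,m}\<close> are rendered by a finite type \<open>'m\<close>, so \<open>m = CARD('m)\<close>.\<close>

definition prob_simplex :: "(real ^ 'm) set" where
  "prob_simplex = {q. (\<forall>j. 0 \<le> q $ j) \<and> (\<Sum>j\<in>UNIV. q $ j) = 1}"

text \<open>Meaningful for \<open>CARD('m) \<ge> 2\<close> only, where the maximum is over a nonempty set.\<close>

definition norm_inf2 :: "real ^ 'm \<Rightarrow> real" where
  "norm_inf2 b = Max {\<bar>b $ j\<bar> + \<bar>b $ k\<bar> | j k. j \<noteq> k}"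

text \<open>The entry \<open>C $ j $ k\<close> is the cost \<open>c\<^sub>j\<^sub>k\<close> of predicting label \<open>k\<close> when the true label is \<open>j\<close>.\<close>

definition cost_matrix :: "real ^ 'm ^ 'm \<Rightarrow> bool" where
  "cost_matrix C \<longleftrightarrow>
     (\<forall>j k. 0 \<le> C $ j $ k) \<and> (\<forall>j. C $ j $ j = 0) \<and> (\<forall>j. \<exists>k. k \<noteq> j \<and> 0 < C $ j $ k)"

definition max_cost :: "real ^ 'm ^ 'm \<Rightarrow> real ^ 'm" where
  "max_cost C = (\<chi> j. Max (range (\<lambda>k. C $ j $ k)))"

definition cost_bar :: "real ^ 'm ^ 'm \<Rightarrow> real ^ 'm ^ 'm" where
  "cost_bar C = (\<chi> j k. max_cost C $ j * (1 :: real ^ 'm) $ k) - C"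

text \<open>Multiplication on \<^typ>\<open>ereal\<close> satisfies \<open>0 * \<infinity> = 0\<close>. Sums are unproblematic for scoring
  rules, since these never take the value \<open>-\<infinity>\<close> on the simplex. Values of \<open>L\<close> outside the
  simplex are never used.\<close>

definition expected_loss :: "('m \<Rightarrow> real ^ 'm \<Rightarrow> ereal) \<Rightarrow> real ^ 'm \<Rightarrow> real ^ 'm \<Rightarrow> ereal" where
  "expected_loss L \<eta> q = (\<Sum>j\<in>UNIV. ereal (\<eta> $ j) * L j q)"

definition gen_entropy :: "('m \<Rightarrow> real ^ 'm \<Rightarrow> ereal) \<Rightarrow> real ^ 'm \<Rightarrow> ereal" where
  "gen_entropy L \<eta> = (INF q\<in>prob_simplex. expected_loss L \<eta> q)"

definition scoring_rule :: "('m \<Rightarrow> real ^ 'm \<Rightarrow> ereal) \<Rightarrow> bool" where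
  "scoring_rule L \<longleftrightarrow>
     (\<forall>j. \<forall>q\<in>prob_simplex. L j q \<noteq> -\<infinity>) \<and>
     (\<forall>\<eta>\<in>prob_simplex. \<bar>gen_entropy L \<eta>\<bar> \<noteq> \<infinity>)"

definition regret :: "('m \<Rightarrow> real ^ 'm \<Rightarrow> ereal) \<Rightarrow> real ^ 'm \<Rightarrow> real ^ 'm \<Rightarrow> ereal" where
  "regret L \<eta> q = expected_loss L \<eta> q - gen_entropy L \<eta>"

text \<open>A tie-breaking rule is a function choosing, for every \<open>\<gamma>\<close>, one maximizing label.\<close>

definition argmax_rule :: "(real ^ 'm \<Rightarrow> 'm) \<Rightarrow> bool" where
  "argmax_rule amax \<longleftrightarrow> (\<forall>\<gamma>. is_arg_max (\<lambda>l. \<gamma> $ l) (\<lambda>l. True) (amax \<gamma>))"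

definition cw_loss :: "(real ^ 'm \<Rightarrow> 'm) \<Rightarrow> real ^ 'm ^ 'm \<Rightarrow> 'm \<Rightarrow> real ^ 'm \<Rightarrow> real" where
  "cw_loss amax C j \<gamma> = C $ j $ amax \<gamma>"

definition cw_regret :: "(real ^ 'm \<Rightarrow> 'm) \<Rightarrow> real ^ 'm ^ 'm \<Rightarrow> real ^ 'm \<Rightarrow> real ^ 'm \<Rightarrow> real" where
  "cw_regret amax C \<eta> \<gamma> =
     (\<Sum>j\<in>UNIV. \<eta> $ j * cw_loss amax C j \<gamma>) - Min (range (\<lambda>k. \<eta> \<bullet> column k C))"

text \<open>The infimum of the empty set is \<open>\<infinity>\<close> in \<^typ>\<open>ereal\<close>. Only arguments \<open>t \<ge> 0\<close> are of interest.\<close>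

definition psi :: "('m \<Rightarrow> real ^ 'm \<Rightarrow> ereal) \<Rightarrow> real ^ 'm ^ 'm \<Rightarrow> real ^ 'm \<Rightarrow> real \<Rightarrow> ereal" where
  "psi L C q t =
     (INF \<eta>'\<in>{\<eta>' \<in> prob_simplex. norm_inf2 (transpose (cost_bar C) *v (\<eta>' - q)) \<ge> t}. regret L \<eta>' q)"

end

theory Submission
  imports Defs
begin

text \<open>The linear map \<open>transpose (cost_bar C)\<close> turns label distributions into expected utilities,
  so the classification regret of predicting \<open>a\<close> is a difference \<open>u\<^sub>k - u\<^sub>a\<close> of two components of
  the utility at \<open>\<eta>\<close>. As \<open>a\<close> maximizes the utility at \<open>q\<close>, the same difference at \<open>q\<close> is not
  positive; subtracting it bounds the regret by the \<open>\<infinity>2\<close>-norm of the difference of the two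
  utilities. Hence \<open>\<eta>\<close> itself is feasible in the infimum that defines \<open>psi\<close>.\<close>

lemma norm_inf2_ge:
  fixes b :: "real ^ 'm"
  assumes "j \<noteq> k"
  shows "\<bar>b $ j\<bar> + \<bar>b $ k\<bar> \<le> norm_inf2 b"
proof -
  have "{\<bar>b $ j\<bar> + \<bar>b $ k\<bar> | j k. j \<noteq> k} \<subseteq> (\<lambda>(j, k). \<bar>b $ j\<bar> + \<bar>b $ k\<bar>) ` UNIV"
    by auto
  then have "finite {\<bar>b $ j\<bar> + \<bar>b $ k\<bar> | j k. j \<noteq> k}"
    by (rule finite_subset) simp
  then show ?thesis
    unfolding norm_inf2_def using assms by (intro Max_ge) auto
qed

text \<open>Two labels make the maximum range over a nonempty set of nonnegative sums. This serves
  the case of zero regret, where no pair of distinct labels is at hand.\<close>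

lemma norm_inf2_nonneg:
  fixes b :: "real ^ 'm"
  assumes "CARD('m) \<ge> 2"
  shows "0 \<le> norm_inf2 b"
proof -
  obtain j k :: 'm where "j \<noteq> k"
    using assms card_2_iff' [of "UNIV :: 'm set"] card_le_Suc0_iff_eq [of "UNIV :: 'm set"] by fastforce
  from norm_inf2_ge [OF this, of b] show ?thesis
    using abs_ge_zero [of "b $ j"] abs_ge_zero [of "b $ k"] by linarith
qed

text \<open>The term \<open>max_cost C \<bullet> x\<close> is the same for every \<open>k\<close>,
  so differences of components are differences of expected costs with the sign reversed.\<close>

lemma transpose_cost_bar_nth:
  fixes C :: "real ^ 'm ^ 'm"
  shows "(transpose (cost_bar C) *v x) $ k = max_cost C \<bullet> x - x \<bullet> column k C"
  by (simp add: matrix_vector_mult_def transpose_def cost_bar_def column_def inner_vec_def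
      algebra_simps sum_subtractf)

lemma cw_regret_le_norm_inf2:
  fixes C :: "real ^ 'm ^ 'm"
  assumes "CARD('m) \<ge> 2" and "argmax_rule amax"
  shows "cw_regret amax C \<eta> (transpose (cost_bar C) *v q)
           \<le> norm_inf2 (transpose (cost_bar C) *v (\<eta> - q))"
proof -
  define U where "U x = transpose (cost_bar C) *v x" for x
  define a where "a = amax (U q)"
  have "Min (range (\<lambda>k. \<eta> \<bullet> column k C)) \<in> range (\<lambda>k. \<eta> \<bullet> column k C)"
    by (intro Min_in) auto
  then obtain k where k: "Min (range (\<lambda>k. \<eta> \<bullet> column k C)) = \<eta> \<bullet> column k C"
    by blast
  have "cw_regret amax C \<eta> (U q) = \<eta> \<bullet> column a C - \<eta> \<bullet> column k C"
    unfolding cw_regret_def k by (simp add: cw_loss_def a_def inner_vec_def column_def)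
  also have "\<dots> = U \<eta> $ k - U \<eta> $ a"
    unfolding U_def transpose_cost_bar_nth by simp
  finally have regret: "cw_regret amax C \<eta> (U q) = U \<eta> $ k - U \<eta> $ a" .
  have "U q $ k \<le> U q $ a"
    using assms(2) by (auto simp: argmax_rule_def is_arg_max_linorder a_def)
  moreover have "U (\<eta> - q) = U \<eta> - U q"
    by (simp add: U_def matrix_vector_mult_diff_distrib)
  ultimately have "cw_regret amax C \<eta> (U q) \<le> U (\<eta> - q) $ k - U (\<eta> - q) $ a"
    by (simp add: regret)
  also have "\<dots> \<le> norm_inf2 (U (\<eta> - q))"
  proof (cases "k = a")
    \<comment> \<open>The predicted label is itself the chosen cost minimizer, so the difference is
      0.\<close>
    case True
    then show ?thesis by (simp add: norm_inf2_nonneg assms(1))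
  next
    case False
    from norm_inf2_ge [OF this, of "U (\<eta> - q)"] show ?thesis by linarith
  qed
  finally show ?thesis by (simp add: U_def)
qed

text \<open>Raising the threshold shrinks the feasible set, possibly to the empty set with infimum
  \<open>\<infinity>\<close>, so the infimum can only grow.\<close>

lemma mono_psi: "mono (psi L C q)"
  unfolding psi_def by (intro monoI INF_superset_mono) auto

theorem proposition12:
  fixes C :: "real ^ 'm ^ 'm"
    and L :: "'m \<Rightarrow> real ^ 'm \<Rightarrow> ereal"
    and amax :: "real ^ 'm \<Rightarrow> 'm"
  assumes "CARD('m) \<ge> 2"
    and "cost_matrix C"
    and "scoring_rule L"
    and "argmax_rule amax"
  shows "(\<forall>q\<in>prob_simplex. mono_on {0..} (psi L C q)) \<and>
    (\<forall>\<eta>\<in>prob_simplex. \<forall>q\<in>prob_simplex.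
       psi L C q (cw_regret amax C \<eta> (transpose (cost_bar C) *v q)) \<le> regret L \<eta> q)"
proof (intro conjI ballI)
  fix q :: "real ^ 'm"
  show "mono_on {0..} (psi L C q)"
    using mono_psi by (rule mono_on_subset) simp
next
  fix \<eta> q :: "real ^ 'm"
  assume "\<eta> \<in> prob_simplex"
  then show "psi L C q (cw_regret amax C \<eta> (transpose (cost_bar C) *v q)) \<le> regret L \<eta> q"
    unfolding psi_def using cw_regret_le_norm_inf2 [OF assms(1,4)] by (intro INF_lower) simp
qed

end
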